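(* For every real $s>1$ the series $$F(s)=\sum_{(a,b,c,d)} f(a,b,c,d)^s,$$ where the sum runs over all quadruples of non-negative integers $a,b,c,d$ with $ad-bc=1$, converges.
   Context: Here $f(a,b,c,d)=\sqrt{a^2+b^2}+\sqrt{c^2+d^2}-\sqrt{(a+c)^2+(b+d)^2}$. *)

theory Defs
  imports "HOL-Analysis.Analysis"
begin

definition triangle_defect :: "real \<Rightarrow> real \<Rightarrow> real \<Rightarrow> real \<Rightarrow> real" where
  "triangle_defect a b c d =
     sqrt (a\<^sup>2 + b\<^sup>2) + sqrt (c\<^sup>2 + d\<^sup>2) - sqrt ((a + c)\<^sup>2 + (b + d)\<^sup>2)"

text \<open>
  The determinant is taken in the integers, since subtraction of natural numbers truncates.
\<close>

definition unimodular_quadruples :: "(nat \<times> nat \<times> nat \<times> nat) set" where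
  "unimodular_quadruples = {(a, b, c, d). int a * int d - int b * int c = 1}"

end

theory Submission
  imports Defs
begin

text \<open>
  Write \<open>u = (a, b)\<close> and \<open>v = (c, d)\<close>. Since \<open>|u|\<^sup>2 |v|\<^sup>2 - (u \<bullet> v)\<^sup>2\<close> is the square of the
  determinant, rationalising twice gives, for determinant \<open>1\<close>,
  \<open>f (a, b, c, d) = 2 / ((|u||v| + u \<bullet> v) (|u| + |v| + |u + v|))\<close>. As \<open>u \<bullet> v\<close>
  is nonnegative in the first quadrant, where \<open>|u| \<ge> 1\<close> and \<open>|u + v| \<ge> |v|\<close>, this is at most
  \<open>1 / |v|\<^sup>2\<close>, and by symmetry at most \<open>1 / |u|\<^sup>2\<close> (\<open>triangle_defect_le_inverse_norm_square\<close>).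

  It remains to avoid counting a vector too often. Put \<open>p = a + b\<close> and \<open>q = c + d\<close>; the
  determinant is also \<open>a q - p c\<close>. If \<open>p \<le> q\<close>, then \<open>p\<close> lies in \<open>{1..q}\<close> and satisfies
  \<open>p c \<equiv> -1 (mod q)\<close>, so \<open>v\<close> determines the whole quadruple; if \<open>q \<le> p\<close>, then \<open>u\<close> does
  (\<open>inj_on_larger_vector\<close>). Thus on either half the series is dominated by
  the sum of \<open>|w| powr (-2 s)\<close> over the nonzero lattice points \<open>w\<close> of the quadrant, which converges
  exactly because \<open>2 s > 2\<close>. Bounding \<open>(1 + x)(1 + y)\<close> by \<open>4 |w|\<^sup>2\<close> for \<open>w = (x, y)\<close> turns
  that sum into a product of two convergent series in one variable.
\<close>

lemma triangle_defect_nonneg: "0 \<le> triangle_defect a b c d"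
  using real_sqrt_sum_squares_triangle_ineq[of a c b d] by (simp add: triangle_defect_def)

lemma triangle_defect_commute: "triangle_defect a b c d = triangle_defect c d a b"
  by (simp add: triangle_defect_def add.commute)

text \<open>
  The two factorisations are \<open>(x + y - w)(x + y + w) = 2 (x y - t)\<close> and, from Lagrange's identity,
  \<open>(x y - t)(x y + t) = 1\<close>; the second factors are at least \<open>2 y\<close> and \<open>y\<close>, where \<open>x, y, w\<close> are the
  three lengths and \<open>t\<close> is the inner product. The determinant enters through its square because
  exchanging the two vectors changes its sign, and the bound is wanted for both of them.
\<close>

lemma triangle_defect_le_inverse_norm_square:
  fixes a b c d :: real
  assumes "0 \<le> a" "0 \<le> b" "0 \<le> c" "0 \<le> d"
    and det: "(a * d - b * c)\<^sup>2 = 1"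
    and u: "1 \<le> a\<^sup>2 + b\<^sup>2" and v: "1 \<le> c\<^sup>2 + d\<^sup>2"
  shows "triangle_defect a b c d \<le> 1 / (c\<^sup>2 + d\<^sup>2)"
proof -
  define x where "x = sqrt (a\<^sup>2 + b\<^sup>2)"
  define y where "y = sqrt (c\<^sup>2 + d\<^sup>2)"
  define w where "w = sqrt ((a + c)\<^sup>2 + (b + d)\<^sup>2)"
  define t where "t = a * c + b * d"
  have x1: "1 \<le> x" and y1: "1 \<le> y" using u v by (simp_all add: x_def y_def)
  have x2: "x\<^sup>2 = a\<^sup>2 + b\<^sup>2" and y2: "y\<^sup>2 = c\<^sup>2 + d\<^sup>2" and w2: "w\<^sup>2 = (a + c)\<^sup>2 + (b + d)\<^sup>2"
    by (simp_all add: x_def y_def w_def)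
  have t0: "0 \<le> t" using assms by (simp add: t_def)
  have yw: "y \<le> w" unfolding y_def w_def
    using assms by (intro real_sqrt_le_mono add_mono power_mono) auto
  have f: "triangle_defect a b c d = x + y - w"
    by (simp add: triangle_defect_def x_def y_def w_def)
  have fnn: "0 \<le> x + y - w" using triangle_defect_nonneg[of a b c d] f by simp
  have "(x * y)\<^sup>2 - t\<^sup>2 = 1"
    using det unfolding power_mult_distrib x2 y2 t_def by (simp add: power2_eq_square algebra_simps)
  then have lagrange: "(x * y - t) * (x * y + t) = 1"
    by (simp add: power2_eq_square algebra_simps)
  have xy: "y \<le> x * y" using x1 y1 by simp
  have "0 < x * y + t" using xy y1 t0 by linarith
  then have pos: "0 < x * y - t"
    using lagrange by (metis less_numeral_extra(1) zero_less_mult_pos2)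
  have "(x + y - w) * (x + y + w) = 2 * (x * y - t)"
    using x2 y2 w2 by (simp add: power2_eq_square algebra_simps t_def)
  moreover have "(x + y - w) * (2 * y) \<le> (x + y - w) * (x + y + w)"
    using x1 yw fnn by (intro mult_left_mono) auto
  ultimately have "(x + y - w) * y \<le> x * y - t" by simp
  then have "(x + y - w) * y * y \<le> (x * y - t) * (x * y + t)"
    using xy t0 pos y1 fnn by (intro mult_mono) linarith+
  then have "(x + y - w) * y\<^sup>2 \<le> 1"
    using lagrange by (simp add: power2_eq_square)
  then show ?thesis
    using y1 v by (simp add: f y2[symmetric] field_simps)
qed

text \<open>
  The vectors completing \<open>(c, d)\<close> to determinant \<open>1\<close> differ by integer multiples of \<open>(c, d)\<close>, so
  their coordinate sums differ by multiples of \<open>c + d\<close>. These sums are positive, as the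
  zero vector has determinant \<open>0\<close>, hence at most one
  of them lies in the range up to \<open>c + d\<close>.
\<close>

lemma unimodular_pair_eq:
  fixes a b a' b' c d :: int
  assumes "0 \<le> a" "0 \<le> b" "0 \<le> a'" "0 \<le> b'" "0 \<le> c" "0 \<le> d"
    and det: "a * d - b * c = 1" and det': "a' * d - b' * c = 1"
    and le: "a + b \<le> c + d" and le': "a' + b' \<le> c + d"
  shows "a = a' \<and> b = b'"
proof -
  define q where "q = c + d"
  have q: "q \<noteq> 0" using det assms(5,6) by (cases "c = 0 \<and> d = 0") (auto simp: q_def)
  have "0 < a + b" using det assms(1,2) by (cases "a = 0 \<and> b = 0") auto
  moreover have "0 < a' + b'" using det' assms(3,4) by (cases "a' = 0 \<and> b' = 0") auto
  ultimately have lt: "\<bar>(a + b) - (a' + b')\<bar> < q"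
    using le le' unfolding q_def by linarith
  have e: "a * q - (a + b) * c = 1" "a' * q - (a' + b') * c = 1"
    using det det' by (simp_all add: q_def algebra_simps)
  (* The solutions p of p c = -1 modulo q form a single residue class, because c is a unit. *)
  have "coprime c q"
  proof (rule coprimeI)
    fix k assume "k dvd c" "k dvd q"
    then have "k dvd a * q - (a + b) * c" by simp
    then show "is_unit k" using e by simp
  qed
  moreover have "((a + b) - (a' + b')) * c = q * (a - a')"
    using e by (simp add: algebra_simps)
  then have "q dvd ((a + b) - (a' + b')) * c" by simp
  ultimately have "q dvd (a + b) - (a' + b')"
    by (simp add: coprime_commute coprime_dvd_mult_left_iff)
  then have sum_eq: "(a + b) - (a' + b') = 0"
    using lt by (meson dvd_imp_le_int linorder_not_less order_trans abs_ge_self)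
  then have "a + b = a' + b'" by simp
  then have "a * q = a' * q" using e by (metis diff_add_cancel)
  then show ?thesis using q sum_eq by simp
qed

lemma inj_on_larger_vector:
  shows "inj_on (\<lambda>(a, b, c, d). (c, d)) (unimodular_quadruples \<inter> {(a, b, c, d). a + b \<le> c + d})"
    and "inj_on (\<lambda>(a, b, c, d). (a, b)) (unimodular_quadruples \<inter> {(a, b, c, d). c + d \<le> a + b})"
proof -
  show "inj_on (\<lambda>(a, b, c, d). (c, d)) (unimodular_quadruples \<inter> {(a, b, c, d). a + b \<le> c + d})"
  proof (rule inj_onI, clarsimp simp: unimodular_quadruples_def)
    fix a b a' b' c d :: nat
    assume "int a * int d - int b * int c = 1" "int a' * int d - int b' * int c = 1"
      "a + b \<le> c + d" "a' + b' \<le> c + d"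
    then show "a = a' \<and> b = b'"
      using unimodular_pair_eq[of "int a" "int b" "int a'" "int b'" "int c" "int d"] by simp
  qed
  (* The substitution (a, b, c, d) -> (d, c, b, a) preserves the determinant. *)
  show "inj_on (\<lambda>(a, b, c, d). (a, b)) (unimodular_quadruples \<inter> {(a, b, c, d). c + d \<le> a + b})"
  proof (rule inj_onI, clarsimp simp: unimodular_quadruples_def)
    fix a b c d c' d' :: nat
    assume "int a * int d - int b * int c = 1" "int a * int d' - int b * int c' = 1"
      "c + d \<le> a + b" "c' + d' \<le> a + b"
    then show "c = c' \<and> d = d'"
      using unimodular_pair_eq[of "int d" "int c" "int d'" "int c'" "int b" "int a"]
      by (simp add: algebra_simps)
  qed
qed

lemma summable_on_powr_lattice:
  fixes s :: real
  assumes "s > 1"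
  shows "(\<lambda>(m, n). (4 / ((1 + real m) * (1 + real n))) powr s) summable_on (UNIV :: (nat \<times> nat) set)"
proof -
  define h where "h = (\<lambda>n::nat. (1 + real n) powr (- s))"
  have "summable (\<lambda>n. real n powr (- s))"
    using assms by (simp add: summable_real_powr_iff)
  then have "summable h"
    by (subst (asm) summable_Suc_iff[symmetric]) (simp add: h_def)
  then have h: "h summable_on UNIV"
    by (intro norm_summable_imp_summable_on) (simp add: h_def)
  have "(\<lambda>(m, n). h m * h n) summable_on (UNIV \<times> UNIV)"
  proof (rule summable_on_SigmaI)
    show "((\<lambda>n. case (m, n) of (m, n) \<Rightarrow> h m * h n) has_sum h m * infsum h UNIV) UNIV" for m
      using h by (auto intro!: has_sum_cmult_right)
    show "(\<lambda>m. h m * infsum h UNIV) summable_on UNIV"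
      using h by (intro summable_on_cmult_left) auto
  qed (auto simp: h_def)
  then have "(\<lambda>x. 4 powr s * (case x of (m, n) \<Rightarrow> h m * h n)) summable_on UNIV"
    by (intro summable_on_cmult_right) simp
  then show ?thesis
    by (rule summable_on_cong[THEN iffD1, rotated])
       (auto simp: h_def powr_divide powr_mult powr_minus inverse_powr divide_inverse)
qed

lemma inverse_norm_square_le:
  fixes m n :: nat
  assumes "(m, n) \<noteq> (0, 0)"
  shows "1 \<le> (real m)\<^sup>2 + (real n)\<^sup>2"
    and "1 / ((real m)\<^sup>2 + (real n)\<^sup>2) \<le> 4 / ((1 + real m) * (1 + real n))"
proof -
  have "1 \<le> m\<^sup>2 + n\<^sup>2" using assms by (cases "m = 0") (auto simp: Suc_le_eq)
  then show *: "1 \<le> (real m)\<^sup>2 + (real n)\<^sup>2"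
    by (metis of_nat_1 of_nat_add of_nat_le_iff of_nat_power)
  have sq: "real k \<le> (real k)\<^sup>2" for k
    by (metis of_nat_le_iff of_nat_power le_square power2_eq_square)
  have "(1 + x) * (1 + y) \<le> 4 * (x\<^sup>2 + y\<^sup>2)"
    if "x \<le> x\<^sup>2" "y \<le> y\<^sup>2" "1 \<le> x\<^sup>2 + y\<^sup>2" for x y :: real
    using that sum_squares_bound[of x y] by (simp add: algebra_simps)
  from this[OF sq sq *]
  have "(1 + real m) * (1 + real n) \<le> 4 * ((real m)\<^sup>2 + (real n)\<^sup>2)" .
  then have "4 / (4 * ((real m)\<^sup>2 + (real n)\<^sup>2)) \<le> 4 / ((1 + real m) * (1 + real n))"
    using * by (intro divide_left_mono mult_pos_pos) auto
  then show "1 / ((real m)\<^sup>2 + (real n)\<^sup>2) \<le> 4 / ((1 + real m) * (1 + real n))"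
    by (subst (asm) divide_divide_eq_left[symmetric]) simp
qed

lemma triangle_defect_unimodular_le:
  assumes "(a, b, c, d) \<in> unimodular_quadruples"
  shows "triangle_defect a b c d \<le> 4 / ((1 + real c) * (1 + real d))"
    and "triangle_defect a b c d \<le> 4 / ((1 + real a) * (1 + real b))"
proof -
  have det: "int a * int d - int b * int c = 1"
    using assms by (simp add: unimodular_quadruples_def)
  then have "real_of_int (int a * int d - int b * int c) = 1" by simp
  then have rdet: "real a * real d - real b * real c = 1" by simp
  have u: "(a, b) \<noteq> (0, 0)" and v: "(c, d) \<noteq> (0, 0)" using det by (intro notI; simp)+
  note nu = inverse_norm_square_le[OF u] and nv = inverse_norm_square_le[OF v]
  have "triangle_defect a b c d \<le> 1 / ((real c)\<^sup>2 + (real d)\<^sup>2)"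
    using rdet nu nv by (intro triangle_defect_le_inverse_norm_square) auto
  with nv show "triangle_defect a b c d \<le> 4 / ((1 + real c) * (1 + real d))" by linarith
  have "real c * real b - real d * real a = -1" using rdet by (simp add: algebra_simps)
  then have "triangle_defect c d a b \<le> 1 / ((real a)\<^sup>2 + (real b)\<^sup>2)"
    using nu nv by (intro triangle_defect_le_inverse_norm_square) auto
  with nu show "triangle_defect a b c d \<le> 4 / ((1 + real a) * (1 + real b))"
    by (subst triangle_defect_commute) linarith
qed

lemma summable_on_dominated_inj:
  fixes f :: "'a \<Rightarrow> real" and g :: "'b \<Rightarrow> real"
  assumes "g summable_on UNIV" "inj_on h A"
    and "\<And>x. x \<in> A \<Longrightarrow> 0 \<le> f x" "\<And>x. x \<in> A \<Longrightarrow> f x \<le> g (h x)"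
  shows "f summable_on A"
proof (rule summable_on_comparison_test)
  have "g summable_on h ` A" using assms(1) by (rule summable_on_subset_banach) simp
  then show "(g \<circ> h) summable_on A" using assms(2) by (simp add: summable_on_reindex)
qed (use assms(3,4) in auto)

theorem lemma4:
  fixes s :: real
  assumes "s > 1"
  shows "(\<lambda>(a, b, c, d). triangle_defect (real a) (real b) (real c) (real d) powr s)
           summable_on unimodular_quadruples"
    (is "?f summable_on ?U")
proof -
  let ?V = "?U \<inter> {(a, b, c, d). a + b \<le> c + d}"
  let ?W = "?U \<inter> {(a, b, c, d). c + d \<le> a + b}"
  have "?f summable_on ?V"
    using assms
    by (intro summable_on_dominated_inj[OF summable_on_powr_lattice inj_on_larger_vector(1)])
       (auto intro!: powr_mono2 triangle_defect_nonneg triangle_defect_unimodular_le(1))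
  moreover have "?f summable_on ?W"
    using assms
    by (intro summable_on_dominated_inj[OF summable_on_powr_lattice inj_on_larger_vector(2)])
       (auto intro!: powr_mono2 triangle_defect_nonneg triangle_defect_unimodular_le(2))
  then have "?f summable_on (?W - ?V)" by (rule summable_on_subset_banach) auto
  ultimately have "?f summable_on (?V \<union> (?W - ?V))" by (intro summable_on_Un_disjoint) auto
  moreover have "?V \<union> (?W - ?V) = ?U" by auto
  ultimately show ?thesis by simp
qed

end
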